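(* Let $G$ be a group and let $n$ be a positive integer. Then the group of all invertible elements of $\mathrm M^{\oplus}_n(G^{\sqcup0})$ is isomorphic to the wreath product $G\wr\mathfrak S_n$.
   Context: For a group $G$, $G^{\sqcup0}=G\cup\{0\}$ is $G$ with a new zero element adjoined; it is an inverse semigroup with zero, where $0^{-1}=0$. In an inverse semigroup with zero, $x,y$ are orthogonal if $x^{-1}y=xy^{-1}=0$, and $x\oplus y$ denotes the join of orthogonal $x,y$ for the natural ordering ($x\le y$ iff $x=yx^{-1}x$), when it exists; in $G^{\sqcup0}$, $x$ and $y$ are orthogonal iff one of them is $0$, and then $x\oplus y$ is the other one. A generalized rook matrix of order $n$ over $S=G^{\sqcup0}$ is a matrix $(x_{i,j})_{1\le i,j\le n}$ with entries in $S$ such that $x_{i,j}^{-1}x_{i,k}=x_{j,i}x_{k,i}^{-1}=0$ whenever $j\ne k$. The monoid $\mathrm M^{\oplus}_n(S)$ consists of all these matrices with multiplication $(xy)_{i,j}=\bigoplus_kx_{i,k}y_{k,j}$. $G\wr\mathfrak S_n=G^n\rtimes\mathfrak S_n$, where the symmetric group $\mathfrak S_n$ on $\{1,\dots,n\}$ permutes the coordinates. *)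

theory Defs
  imports "HOL-Algebra.Algebra"
begin

section \<open>Inverse semigroups with zero\<close>

record 'a zero_monoid = "'a monoid" +
  zero_elem :: 'a

text \<open>The inverse of an inverse semigroup: the unique \<open>y\<close> with \<open>xyx = x\<close> and \<open>yxy = y\<close>.
  In contrast to \<^const>\<open>m_inv\<close>, it is defined at every element, zero included.\<close>

definition sinv :: "('a, 'b) monoid_scheme \<Rightarrow> 'a \<Rightarrow> 'a" where
  "sinv S x = (THE y. y \<in> carrier S \<and> x \<otimes>\<^bsub>S\<^esub> y \<otimes>\<^bsub>S\<^esub> x = x \<and> y \<otimes>\<^bsub>S\<^esub> x \<otimes>\<^bsub>S\<^esub> y = y)"

definition orthogonal :: "('a, 'b) zero_monoid_scheme \<Rightarrow> 'a \<Rightarrow> 'a \<Rightarrow> bool" where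
  "orthogonal S x y \<longleftrightarrow> sinv S x \<otimes>\<^bsub>S\<^esub> y = zero_elem S \<and> x \<otimes>\<^bsub>S\<^esub> sinv S y = zero_elem S"

definition natural_order :: "('a, 'b) monoid_scheme \<Rightarrow> 'a gorder" where
  "natural_order S = \<lparr>carrier = carrier S, eq = (=),
     le = (\<lambda>x y. x = y \<otimes>\<^bsub>S\<^esub> sinv S x \<otimes>\<^bsub>S\<^esub> x)\<rparr>"

text \<open>The orthogonal join of a family: its join in the natural order, provided that its members
  are pairwise orthogonal. For a two-element index set this is the binary partial operation
  \<open>x \<oplus> y\<close>.\<close>

definition orth_join :: "('a, 'b) zero_monoid_scheme \<Rightarrow> 'i set \<Rightarrow> ('i \<Rightarrow> 'a) \<Rightarrow> 'a" where
  "orth_join S I f =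
     (if \<forall>i\<in>I. \<forall>j\<in>I. i \<noteq> j \<longrightarrow> orthogonal S (f i) (f j)
      then \<Squnion>\<^bsub>natural_order S\<^esub> (f ` I) else undefined)"

definition adjoin_zero :: "('a, 'b) monoid_scheme \<Rightarrow> 'a option zero_monoid" where
  "adjoin_zero G = \<lparr>carrier = insert None (Some ` carrier G),
     Group.monoid.mult = (\<lambda>x y. case (x, y) of (Some a, Some b) \<Rightarrow> Some (a \<otimes>\<^bsub>G\<^esub> b) | _ \<Rightarrow> None),
     one = Some \<one>\<^bsub>G\<^esub>,
     zero_elem = None\<rparr>"

section \<open>Generalized rook matrices\<close>

text \<open>A matrix of order \<open>n\<close> is a function on \<open>{1..n} \<times> {1..n}\<close>, equal to \<^const>\<open>undefined\<close> outside
  that set, so that equality of matrices is equality of entries.\<close>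

definition rook_matrices :: "nat \<Rightarrow> ('a, 'b) zero_monoid_scheme \<Rightarrow> (nat \<times> nat \<Rightarrow> 'a) set" where
  "rook_matrices n S = {x \<in> {1..n} \<times> {1..n} \<rightarrow>\<^sub>E carrier S.
     \<forall>i\<in>{1..n}. \<forall>j\<in>{1..n}. \<forall>k\<in>{1..n}. j \<noteq> k \<longrightarrow>
       sinv S (x (i, j)) \<otimes>\<^bsub>S\<^esub> x (i, k) = zero_elem S \<and> x (j, i) \<otimes>\<^bsub>S\<^esub> sinv S (x (k, i)) = zero_elem S}"

definition rook_monoid :: "nat \<Rightarrow> ('a, 'b) zero_monoid_scheme \<Rightarrow> (nat \<times> nat \<Rightarrow> 'a) monoid" where
  "rook_monoid n S = \<lparr>carrier = rook_matrices n S,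
     Group.monoid.mult = (\<lambda>x y. \<lambda>(i, j)\<in>{1..n} \<times> {1..n}.
               orth_join S {1..n} (\<lambda>k. x (i, k) \<otimes>\<^bsub>S\<^esub> y (k, j))),
     one = (\<lambda>(i, j)\<in>{1..n} \<times> {1..n}. if i = j then \<one>\<^bsub>S\<^esub> else zero_elem S)\<rparr>"

section \<open>Wreath products\<close>

definition semidirect_product ::
  "('a, 'c) monoid_scheme \<Rightarrow> ('b, 'd) monoid_scheme \<Rightarrow> ('b \<Rightarrow> 'a \<Rightarrow> 'a) \<Rightarrow> ('a \<times> 'b) monoid" where
  "semidirect_product N H \<phi> = \<lparr>carrier = carrier N \<times> carrier H,
     Group.monoid.mult = (\<lambda>(a, s) (b, t). (a \<otimes>\<^bsub>N\<^esub> \<phi> s b, s \<otimes>\<^bsub>H\<^esub> t)),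
     one = (\<one>\<^bsub>N\<^esub>, \<one>\<^bsub>H\<^esub>)\<rparr>"

text \<open>A permutation moves the \<open>i\<close>-th coordinate to position \<open>s i\<close>; the inverse below makes this a
  left action, as \<^const>\<open>sym_group\<close> multiplies by composition.\<close>

definition wreath_sym :: "('a, 'b) monoid_scheme \<Rightarrow> nat \<Rightarrow> ((nat \<Rightarrow> 'a) \<times> (nat \<Rightarrow> nat)) monoid" where
  "wreath_sym G n = semidirect_product (product_group {1..n} (\<lambda>_. G)) (sym_group n)
     (\<lambda>s a. \<lambda>i\<in>{1..n}. a ((inv\<^bsub>sym_group n\<^esub> s) i))"

end

theory Submission
  imports Defs
begin

text \<open>Among the elements of a group with zero adjoined, two are orthogonal exactly if one of them is
  zero, so a rook matrix is a matrix with at most one nonzero entry in each row and in each column.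
  In the product of two rook matrices every orthogonal join has therefore at most one nonzero
  member and is equal to it (\<open>orth_join_eq\<close>, \<open>rook_mult_entry\<close>).

  A vector \<open>a\<close> over the group and a permutation \<open>s\<close> give the monomial matrix whose only nonzero entry
  in column \<open>j\<close> lies in row \<open>s j\<close> and is the coordinate of \<open>a\<close> at that row. Multiplying monomial
  matrices composes the permutations and multiplies the vectors after a permutation of the
  coordinates, which is the multiplication of the wreath product (\<open>monomial_mult\<close>).

  So monomial matrices are invertible. Conversely, if \<open>y x = 1\<close>, then no column of \<open>x\<close> vanishes, for
  otherwise that column of \<open>y x\<close> would vanish as well. Hence every column of \<open>x\<close> has exactly one
  nonzero entry, and the map that sends a column to the row of this entry is injective, because rows
  have at most one nonzero entry too. An injective self-map of a finite set is a permutation, and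
  \<open>x\<close> is monomial (\<open>monomial_if_columns_nonzero\<close>).\<close>

section \<open>Groups with zero adjoined\<close>

lemma adjoin_zero_simps [simp]:
  "carrier (adjoin_zero G) = insert None (Some ` carrier G)"
  "\<one>\<^bsub>adjoin_zero G\<^esub> = Some \<one>\<^bsub>G\<^esub>"
  "zero_elem (adjoin_zero G) = None"
  "None \<otimes>\<^bsub>adjoin_zero G\<^esub> y = None"
  "x \<otimes>\<^bsub>adjoin_zero G\<^esub> None = None"
  "Some a \<otimes>\<^bsub>adjoin_zero G\<^esub> Some b = Some (a \<otimes>\<^bsub>G\<^esub> b)"
  by (auto simp: adjoin_zero_def split: option.splits)

lemma adjoin_zero_mult_eq_None [simp]:
  "x \<otimes>\<^bsub>adjoin_zero G\<^esub> y = None \<longleftrightarrow> x = None \<or> y = None"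
  by (cases x; cases y) auto

context group
begin

lemma sinv_adjoin_zero_None [simp]: "sinv (adjoin_zero G) None = None"
  unfolding sinv_def by (rule the_equality) auto

lemma sinv_adjoin_zero_Some [simp]:
  assumes "a \<in> carrier G"
  shows "sinv (adjoin_zero G) (Some a) = Some (inv a)"
  unfolding sinv_def
proof (rule the_equality)
  show "Some (inv a) \<in> carrier (adjoin_zero G) \<and>
    Some a \<otimes>\<^bsub>adjoin_zero G\<^esub> Some (inv a) \<otimes>\<^bsub>adjoin_zero G\<^esub> Some a = Some a \<and>
    Some (inv a) \<otimes>\<^bsub>adjoin_zero G\<^esub> Some a \<otimes>\<^bsub>adjoin_zero G\<^esub> Some (inv a) = Some (inv a)"
    using assms by simp
next
  fix y
  assume y: "y \<in> carrier (adjoin_zero G) \<and>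
    Some a \<otimes>\<^bsub>adjoin_zero G\<^esub> y \<otimes>\<^bsub>adjoin_zero G\<^esub> Some a = Some a \<and>
    y \<otimes>\<^bsub>adjoin_zero G\<^esub> Some a \<otimes>\<^bsub>adjoin_zero G\<^esub> y = y"
  then obtain b where b: "y = Some b" by (cases y) auto
  then have bG: "b \<in> carrier G" and "a \<otimes> b \<otimes> a = a" using y by auto
  then have "a \<otimes> b = \<one>" using assms r_cancel_one by simp
  then show "y = Some (inv a)" using b bG assms inv_equality inv_comm by metis
qed

lemma sinv_adjoin_zero_eq_None [simp]:
  "x \<in> carrier (adjoin_zero G) \<Longrightarrow> sinv (adjoin_zero G) x = None \<longleftrightarrow> x = None"
  by auto

lemma orthogonal_adjoin_zero:
  assumes "x \<in> carrier (adjoin_zero G)" "y \<in> carrier (adjoin_zero G)"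
  shows "orthogonal (adjoin_zero G) x y \<longleftrightarrow> x = None \<or> y = None"
  using assms by (simp add: orthogonal_def del: adjoin_zero_simps(1))

text \<open>The natural order of a group is equality, since \<open>y x\<inverse> x = y\<close>; adjoining a zero adds a least
  element.\<close>

lemma natural_order_adjoin_zero:
  assumes "x \<in> carrier (adjoin_zero G)" "y \<in> carrier (adjoin_zero G)"
  shows "x \<sqsubseteq>\<^bsub>natural_order (adjoin_zero G)\<^esub> y \<longleftrightarrow> x = None \<or> x = y"
  using assms by (auto simp: natural_order_def m_assoc)

text \<open>A family of pairwise orthogonal elements has at most one nonzero member. The index \<open>k\<close> is the
  place of that member, or any index if the whole family vanishes.\<close>

lemma orth_join_eq:
  assumes f: "\<And>i. i \<in> I \<Longrightarrow> f i \<in> carrier (adjoin_zero G)"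
    and k: "k \<in> I" and others: "\<And>i. i \<in> I \<Longrightarrow> i \<noteq> k \<Longrightarrow> f i = None"
  shows "orth_join (adjoin_zero G) I f = f k"
proof -
  let ?S = "adjoin_zero G"
  let ?L = "natural_order ?S"
  have carr: "carrier ?L = carrier ?S" by (simp add: natural_order_def)
  have orth: "\<forall>i\<in>I. \<forall>j\<in>I. i \<noteq> j \<longrightarrow> orthogonal ?S (f i) (f j)"
    using f others orthogonal_adjoin_zero by metis
  have upper: "Upper ?L (f ` I) = {u \<in> carrier ?S. f k = None \<or> f k = u}"
  proof (intro Set.set_eqI iffI)
    fix u assume "u \<in> Upper ?L (f ` I)"
    then show "u \<in> {u \<in> carrier ?S. f k = None \<or> f k = u}"
      using k f[OF k] natural_order_adjoin_zero[of "f k" u]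
      unfolding Upper_def carr by blast
  next
    fix u assume u: "u \<in> {u \<in> carrier ?S. f k = None \<or> f k = u}"
    have "f i \<sqsubseteq>\<^bsub>?L\<^esub> u" if "i \<in> I" for i
      using u f[OF that] others[OF that] natural_order_adjoin_zero[of "f i" u] by auto
    then show "u \<in> Upper ?L (f ` I)"
      using u unfolding Upper_def carr by blast
  qed
  have least: "least ?L x (Upper ?L (f ` I)) \<longleftrightarrow> x = f k" for x
  proof
    assume x: "least ?L x (Upper ?L (f ` I))"
    then have "x \<in> carrier ?S" "f k = None \<or> f k = x" "x \<sqsubseteq>\<^bsub>?L\<^esub> f k"
      using f[OF k] unfolding least_def upper by blast+
    then show "x = f k" using natural_order_adjoin_zero f[OF k] by metis
  next
    assume "x = f k"
    then show "least ?L x (Upper ?L (f ` I))"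
      using f[OF k] natural_order_adjoin_zero[OF f[OF k]]
      unfolding least_def upper carr by blast
  qed
  show ?thesis
    using orth by (simp add: orth_join_def sup_def least)
qed

section \<open>Rook matrices over a group with zero adjoined\<close>

lemma mem_rook_matrices_adjoin_zero:
  "x \<in> rook_matrices n (adjoin_zero G) \<longleftrightarrow>
     x \<in> {1..n} \<times> {1..n} \<rightarrow>\<^sub>E carrier (adjoin_zero G) \<and>
     (\<forall>i\<in>{1..n}. \<forall>j\<in>{1..n}. \<forall>k\<in>{1..n}. j \<noteq> k \<longrightarrow>
       (x (i, j) = None \<or> x (i, k) = None) \<and> (x (j, i) = None \<or> x (k, i) = None))"
proof -
  have "sinv (adjoin_zero G) (x (i, j)) = None \<longleftrightarrow> x (i, j) = None"
    if "x \<in> {1..n} \<times> {1..n} \<rightarrow>\<^sub>E carrier (adjoin_zero G)" "i \<in> {1..n}" "j \<in> {1..n}" for i j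
    using that by (intro sinv_adjoin_zero_eq_None) (auto simp del: adjoin_zero_simps(1))
  then show ?thesis
    by (simp add: rook_matrices_def del: adjoin_zero_simps(1) cong: conj_cong)
qed

lemma rook_entry_closed:
  "x \<in> rook_matrices n (adjoin_zero G) \<Longrightarrow> i \<in> {1..n} \<Longrightarrow> j \<in> {1..n} \<Longrightarrow>
     x (i, j) \<in> carrier (adjoin_zero G)"
  unfolding mem_rook_matrices_adjoin_zero by blast

lemma rook_mult_entry:
  assumes x: "x \<in> rook_matrices n (adjoin_zero G)" and y: "y \<in> rook_matrices n (adjoin_zero G)"
    and i: "i \<in> {1..n}" and j: "j \<in> {1..n}" and k: "k \<in> {1..n}"
    and others: "\<And>l. l \<in> {1..n} \<Longrightarrow> l \<noteq> k \<Longrightarrow> x (i, l) = None \<or> y (l, j) = None"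
  shows "(x \<otimes>\<^bsub>rook_monoid n (adjoin_zero G)\<^esub> y) (i, j) = x (i, k) \<otimes>\<^bsub>adjoin_zero G\<^esub> y (k, j)"
proof -
  have "x (i, l) \<otimes>\<^bsub>adjoin_zero G\<^esub> y (l, j) \<in> carrier (adjoin_zero G)" if "l \<in> {1..n}" for l
    using rook_entry_closed[OF x i that] rook_entry_closed[OF y that j] by auto
  then have "orth_join (adjoin_zero G) {1..n} (\<lambda>l. x (i, l) \<otimes>\<^bsub>adjoin_zero G\<^esub> y (l, j)) =
      x (i, k) \<otimes>\<^bsub>adjoin_zero G\<^esub> y (k, j)"
    using k others by (intro orth_join_eq) simp_all
  then show ?thesis using i j by (simp add: rook_monoid_def)
qed

section \<open>Monomial matrices\<close>

definition monomial_matrix :: "nat \<Rightarrow> (nat \<Rightarrow> 'a) \<times> (nat \<Rightarrow> nat) \<Rightarrow> nat \<times> nat \<Rightarrow> 'a option" where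
  "monomial_matrix n = (\<lambda>(a, s). \<lambda>(i, j)\<in>{1..n} \<times> {1..n}. if i = s j then Some (a i) else None)"

lemma monomial_matrix_entry [simp]:
  "i \<in> {1..n} \<Longrightarrow> j \<in> {1..n} \<Longrightarrow>
     monomial_matrix n (a, s) (i, j) = (if i = s j then Some (a i) else None)"
  by (simp add: monomial_matrix_def)

lemma monomial_rook:
  assumes a: "a \<in> {1..n} \<rightarrow>\<^sub>E carrier G" and s: "s permutes {1..n}"
  shows "monomial_matrix n (a, s) \<in> rook_matrices n (adjoin_zero G)"
proof -
  have "s j = s k \<longleftrightarrow> j = k" for j k using permutes_inj[OF s] by (simp add: inj_eq)
  moreover have "monomial_matrix n (a, s) \<in> {1..n} \<times> {1..n} \<rightarrow>\<^sub>E carrier (adjoin_zero G)"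
    using PiE_mem[OF a] by (auto simp: monomial_matrix_def simp del: atLeastAtMost_iff)
  ultimately show ?thesis
    unfolding mem_rook_matrices_adjoin_zero by auto
qed

lemma carrier_wreath_sym:
  "carrier (wreath_sym G n) = ({1..n} \<rightarrow>\<^sub>E carrier G) \<times> {s. s permutes {1..n}}"
  by (simp add: wreath_sym_def semidirect_product_def sym_group_def)

lemma mult_wreath_sym:
  assumes "s permutes {1..n}"
  shows "(a, s) \<otimes>\<^bsub>wreath_sym G n\<^esub> (b, t) = (\<lambda>i\<in>{1..n}. a i \<otimes> b (inv' s i), s \<circ> t)"
proof -
  have "inv\<^bsub>sym_group n\<^esub> s = inv' s"
    using assms permutes_inv permutes_inv_o
    by (intro group.inv_equality[OF sym_group_is_group])
      (auto simp: sym_group_carrier sym_group_mult sym_group_one)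
  then show ?thesis
    by (auto simp: wreath_sym_def semidirect_product_def sym_group_mult)
qed

lemma mult_wreath_sym_closed:
  assumes "v \<in> carrier (wreath_sym G n)" "w \<in> carrier (wreath_sym G n)"
  shows "v \<otimes>\<^bsub>wreath_sym G n\<^esub> w \<in> carrier (wreath_sym G n)"
proof -
  obtain a s b t where vw: "v = (a, s)" "w = (b, t)" by fastforce
  then have mem: "a \<in> {1..n} \<rightarrow>\<^sub>E carrier G" "b \<in> {1..n} \<rightarrow>\<^sub>E carrier G"
      "s permutes {1..n}" "t permutes {1..n}"
    using assms by (simp_all add: carrier_wreath_sym)
  have "b (inv' s i) \<in> carrier G" if "i \<in> {1..n}" for i
    using mem that permutes_in_image[OF permutes_inv[OF mem(3)], of i] by blast
  then have "(\<lambda>i\<in>{1..n}. a i \<otimes> b (inv' s i)) \<in> {1..n} \<rightarrow>\<^sub>E carrier G"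
    using mem by (intro restrict_PiE_iff[THEN iffD2] ballI m_closed) auto
  then show ?thesis
    using mem permutes_compose by (simp add: vw mult_wreath_sym carrier_wreath_sym)
qed

lemma monomial_mult:
  assumes v: "v \<in> carrier (wreath_sym G n)" and w: "w \<in> carrier (wreath_sym G n)"
  shows "monomial_matrix n (v \<otimes>\<^bsub>wreath_sym G n\<^esub> w) =
    monomial_matrix n v \<otimes>\<^bsub>rook_monoid n (adjoin_zero G)\<^esub> monomial_matrix n w"
proof
  fix p :: "nat \<times> nat"
  obtain i j where p: "p = (i, j)" by fastforce
  obtain a s b t where vw: "v = (a, s)" "w = (b, t)" by fastforce
  then have a: "a \<in> {1..n} \<rightarrow>\<^sub>E carrier G" and b: "b \<in> {1..n} \<rightarrow>\<^sub>E carrier G"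
    and s: "s permutes {1..n}" and t: "t permutes {1..n}"
    using v w by (simp_all add: carrier_wreath_sym)
  show "monomial_matrix n (v \<otimes>\<^bsub>wreath_sym G n\<^esub> w) p =
    (monomial_matrix n v \<otimes>\<^bsub>rook_monoid n (adjoin_zero G)\<^esub> monomial_matrix n w) p"
  proof (cases "i \<in> {1..n} \<and> j \<in> {1..n}")
    case True
    then have tj: "t j \<in> {1..n}" using permutes_in_image[OF t] by simp
    \<comment> \<open>The column \<open>j\<close> of the second factor vanishes outside the row \<open>t j\<close>.\<close>
    have "(monomial_matrix n v \<otimes>\<^bsub>rook_monoid n (adjoin_zero G)\<^esub> monomial_matrix n w) (i, j) =
        monomial_matrix n v (i, t j) \<otimes>\<^bsub>adjoin_zero G\<^esub> monomial_matrix n w (t j, j)"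
      using True tj unfolding vw
      by (intro rook_mult_entry monomial_rook a b s t) auto
    also have "\<dots> = (if i = s (t j) then Some (a i \<otimes> b (t j)) else None)"
      using True tj by (simp add: vw)
    also have "\<dots> = monomial_matrix n (v \<otimes>\<^bsub>wreath_sym G n\<^esub> w) (i, j)"
      using True permutes_inverses(2)[OF s] by (simp add: vw mult_wreath_sym[OF s])
    finally show ?thesis by (simp add: p)
  next
    case False
    then show ?thesis
      by (auto simp: p vw mult_wreath_sym[OF s] monomial_matrix_def rook_monoid_def)
  qed
qed

lemma monomial_one:
  "monomial_matrix n (\<lambda>i\<in>{1..n}. \<one>, id) = \<one>\<^bsub>rook_monoid n (adjoin_zero G)\<^esub>"
  by (auto simp: monomial_matrix_def rook_monoid_def fun_eq_iff)

lemma inj_on_monomial_matrix: "inj_on (monomial_matrix n) (carrier (wreath_sym G n))"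
proof (rule inj_onI)
  fix v w
  assume v: "v \<in> carrier (wreath_sym G n)" and w: "w \<in> carrier (wreath_sym G n)"
    and eq: "monomial_matrix n v = monomial_matrix n w"
  obtain a s b t where vw: "v = (a, s)" "w = (b, t)" by fastforce
  then have a: "a \<in> {1..n} \<rightarrow>\<^sub>E carrier G" and b: "b \<in> {1..n} \<rightarrow>\<^sub>E carrier G"
    and s: "s permutes {1..n}" and t: "t permutes {1..n}"
    using v w by (simp_all add: carrier_wreath_sym)
  have st: "s j = t j \<and> a (s j) = b (s j)" if "j \<in> {1..n}" for j
  proof -
    have "s j \<in> {1..n}" using that permutes_in_image[OF s] by simp
    then show ?thesis
      using fun_cong[OF eq, of "(s j, j)"] that by (simp add: vw split: if_splits)
  qed
  have "s j = t j" for j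
    using st permutes_not_in[OF s] permutes_not_in[OF t] by metis
  moreover have "a i = b i" for i
  proof (cases "i \<in> {1..n}")
    case True
    then have "inv' s i \<in> {1..n}" using permutes_in_image[OF permutes_inv[OF s]] by simp
    then show ?thesis using st[of "inv' s i"] permutes_inverses(1)[OF s] by simp
  next
    case False
    then show ?thesis using PiE_arb[OF a] PiE_arb[OF b] by simp
  qed
  ultimately show "v = w" by (auto simp: vw)
qed

section \<open>Units of the rook monoid\<close>

lemma monomial_Units:
  assumes "w \<in> carrier (wreath_sym G n)"
  shows "monomial_matrix n w \<in> Units (rook_monoid n (adjoin_zero G))"
proof -
  obtain a s where w: "w = (a, s)" by fastforce
  then have a: "a \<in> {1..n} \<rightarrow>\<^sub>E carrier G" and s: "s permutes {1..n}"
    using assms by (simp_all add: carrier_wreath_sym)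
  \<comment> \<open>The matrix of \<open>w'\<close> is the transpose of the matrix of \<open>w\<close> with its nonzero entries inverted.\<close>
  define w' where "w' = (\<lambda>i\<in>{1..n}. inv (a (s i)), inv' s)"
  have in_image: "s i \<in> {1..n}" "inv' s i \<in> {1..n}" if "i \<in> {1..n}" for i
    using that permutes_in_image[OF s, of i] permutes_in_image[OF permutes_inv[OF s], of i] by simp_all
  have ai: "a i \<in> carrier G" if "i \<in> {1..n}" for i using a that by blast
  have w': "w' \<in> carrier (wreath_sym G n)"
    using ai in_image permutes_inv[OF s] by (auto simp: w'_def carrier_wreath_sym)
  have "w \<otimes>\<^bsub>wreath_sym G n\<^esub> w' = (\<lambda>i\<in>{1..n}. \<one>, id)"
    using ai in_image permutes_inverses[OF s] permutes_inv_o[OF s]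
    by (auto simp: w w'_def mult_wreath_sym[OF s] simp del: atLeastAtMost_iff intro!: restrict_ext)
  moreover have "w' \<otimes>\<^bsub>wreath_sym G n\<^esub> w = (\<lambda>i\<in>{1..n}. \<one>, id)"
    using ai in_image permutes_inv_inv[OF s] permutes_inv_o[OF s]
    by (auto simp: w w'_def mult_wreath_sym[OF permutes_inv[OF s]]
        simp del: atLeastAtMost_iff intro!: restrict_ext)
  moreover have "monomial_matrix n v \<in> carrier (rook_monoid n (adjoin_zero G))"
    if "v \<in> carrier (wreath_sym G n)" for v
    using that monomial_rook by (auto simp: carrier_wreath_sym rook_monoid_def)
  ultimately show ?thesis
    using assms w' monomial_mult[OF assms w'] monomial_mult[OF w' assms]
    unfolding Units_def mem_Collect_eq monomial_one[symmetric] by metis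
qed

lemma monomial_if_columns_nonzero:
  assumes x: "x \<in> rook_matrices n (adjoin_zero G)"
    and columns: "\<And>j. j \<in> {1..n} \<Longrightarrow> \<exists>i\<in>{1..n}. x (i, j) \<noteq> None"
  shows "x \<in> monomial_matrix n ` carrier (wreath_sym G n)"
proof -
  have "\<exists>r. \<forall>j\<in>{1..n}. r j \<in> {1..n} \<and> x (r j, j) \<noteq> None"
    using columns by (intro bchoice) blast
  then obtain r where r: "\<And>j. j \<in> {1..n} \<Longrightarrow> r j \<in> {1..n}"
      "\<And>j. j \<in> {1..n} \<Longrightarrow> x (r j, j) \<noteq> None"
    by blast
  have row: "j = k" if "x (i, j) \<noteq> None" "x (i, k) \<noteq> None" "i \<in> {1..n}" "j \<in> {1..n}" "k \<in> {1..n}"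
    for i j k using x that unfolding mem_rook_matrices_adjoin_zero by metis
  have column: "j = k" if "x (j, i) \<noteq> None" "x (k, i) \<noteq> None" "i \<in> {1..n}" "j \<in> {1..n}" "k \<in> {1..n}"
    for i j k using x that unfolding mem_rook_matrices_adjoin_zero by metis
  have "inj_on r {1..n}"
    using r row by (intro inj_onI) metis
  moreover have "r ` {1..n} \<subseteq> {1..n}"
    using r(1) by blast
  ultimately have bij: "bij_betw r {1..n} {1..n}"
    unfolding bij_betw_def using endo_inj_surj by blast
  define s where "s j = (if j \<in> {1..n} then r j else j)" for j
  have s: "s permutes {1..n}"
    using bij bij_betw_cong[of "{1..n}" s r] by (intro bij_imp_permutes) (auto simp: s_def)
  define a where "a = (\<lambda>i\<in>{1..n}. the (x (i, inv' s i)))"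
  have entry: "x (s j, j) = Some (a (s j)) \<and> a (s j) \<in> carrier G" if j: "j \<in> {1..n}" for j
  proof -
    have sj: "s j \<in> {1..n}" "x (s j, j) \<noteq> None" using r j by (simp_all add: s_def)
    then have "x (s j, j) = Some (a (s j))"
      using permutes_inverses(2)[OF s] by (auto simp: a_def)
    then show ?thesis using rook_entry_closed[OF x sj(1) j] by auto
  qed
  have "a i \<in> carrier G" if "i \<in> {1..n}" for i
    using entry[of "inv' s i"] that permutes_in_image[OF permutes_inv[OF s], of i]
      permutes_inverses(1)[OF s] by simp
  then have "(a, s) \<in> carrier (wreath_sym G n)"
    using s by (auto simp: carrier_wreath_sym a_def)
  moreover have "x = monomial_matrix n (a, s)"
  proof
    fix p :: "nat \<times> nat"
    obtain i j where p: "p = (i, j)" by fastforce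
    show "x p = monomial_matrix n (a, s) p"
    proof (cases "i \<in> {1..n} \<and> j \<in> {1..n}")
      case True
      then have "x (i, j) = None" if "i \<noteq> s j"
        using that column r unfolding s_def by metis
      then show ?thesis using True entry[of j] by (auto simp: p)
    next
      case False
      moreover have "x \<in> {1..n} \<times> {1..n} \<rightarrow>\<^sub>E carrier (adjoin_zero G)"
        using x unfolding mem_rook_matrices_adjoin_zero by blast
      ultimately show ?thesis
        using PiE_arb[of x _ _ p] by (auto simp: p monomial_matrix_def)
    qed
  qed
  ultimately show ?thesis by blast
qed

lemma Units_rook_monoid:
  "Units (rook_monoid n (adjoin_zero G)) = monomial_matrix n ` carrier (wreath_sym G n)"
proof (intro equalityI subsetI)
  let ?M = "rook_monoid n (adjoin_zero G)"
  fix x assume "x \<in> Units ?M"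
  then obtain y where x: "x \<in> rook_matrices n (adjoin_zero G)"
      and y: "y \<in> rook_matrices n (adjoin_zero G)" and yx: "y \<otimes>\<^bsub>?M\<^esub> x = \<one>\<^bsub>?M\<^esub>"
    unfolding Units_def by (auto simp: rook_monoid_def)
  have "\<exists>i\<in>{1..n}. x (i, j) \<noteq> None" if j: "j \<in> {1..n}" for j
  proof (rule ccontr)
    assume "\<not> (\<exists>i\<in>{1..n}. x (i, j) \<noteq> None)"
    then have "(y \<otimes>\<^bsub>?M\<^esub> x) (j, j) = None"
      using j rook_mult_entry[OF y x j j j] by simp
    moreover have "\<one>\<^bsub>?M\<^esub> (j, j) = Some \<one>"
      using j by (simp add: rook_monoid_def)
    ultimately show False by (simp add: yx)
  qed
  with x show "x \<in> monomial_matrix n ` carrier (wreath_sym G n)"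
    by (rule monomial_if_columns_nonzero)
qed (auto intro: monomial_Units)

lemma monomial_matrix_iso:
  "monomial_matrix n \<in> iso (wreath_sym G n) (units_of (rook_monoid n (adjoin_zero G)))"
  using monomial_mult inj_on_monomial_matrix
  by (auto simp: iso_iff hom_def units_of_carrier units_of_mult Units_rook_monoid)

end

text \<open>The inverse bijection is multiplicative because both \<open>h\<inverse> (x y)\<close> and \<open>h\<inverse> x h\<inverse> y\<close> are
  mapped to \<open>x y\<close> by \<open>h\<close>; closedness puts the latter into the set on which \<open>h\<close> is injective.\<close>

lemma is_iso_sym_if_closed:
  assumes h: "h \<in> iso H K"
    and closed: "\<And>v w. v \<in> carrier H \<Longrightarrow> w \<in> carrier H \<Longrightarrow> v \<otimes>\<^bsub>H\<^esub> w \<in> carrier H"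
  shows "K \<cong> H"
proof -
  let ?g = "inv_into (carrier H) h"
  have bij: "bij_betw h (carrier H) (carrier K)" and hom: "h \<in> hom H K"
    using h by (auto simp: iso_def)
  have "?g (x \<otimes>\<^bsub>K\<^esub> y) = ?g x \<otimes>\<^bsub>H\<^esub> ?g y" if x: "x \<in> carrier K" and y: "y \<in> carrier K" for x y
  proof -
    have g: "?g x \<in> carrier H" "?g y \<in> carrier H" "h (?g x) = x" "h (?g y) = y"
      using x y bij by (auto simp: bij_betw_def inv_into_into f_inv_into_f)
    then have "h (?g x \<otimes>\<^bsub>H\<^esub> ?g y) = x \<otimes>\<^bsub>K\<^esub> y"
      using hom_mult[OF hom g(1,2)] by simp
    then show ?thesis
      using closed[OF g(1,2)] bij_betw_inv_into_left[OF bij] by metis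
  qed
  then have "?g \<in> iso K H"
    using bij_betw_inv_into[OF bij] by (auto simp: iso_def hom_def bij_betw_def)
  then show ?thesis by (rule is_isoI)
qed

theorem lemma7p4:
  fixes G :: "('a, 'b) monoid_scheme" and n :: nat
  assumes "group G" and "n > 0"
  shows "units_of (rook_monoid n (adjoin_zero G)) \<cong> wreath_sym G n"
  using group.monomial_matrix_iso[OF assms(1)] group.mult_wreath_sym_closed[OF assms(1)]
  by (rule is_iso_sym_if_closed)

end
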